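(* Let $\theta\in\mathbb R$ and let $(X_n)$ be a sequence of iid real random variables. Fix $\gamma\in(0,1/2)$ and $\delta>0$. Let $(T_n)\nearrow\infty$ and $(\epsilon_n)\searrow0$ be nonnegative sequences of real numbers satisfying $T_n=o(n^{\delta\gamma/2}\epsilon_n^{2+\delta/2})$. Let $F$ be any probability distribution on $\mathbb R$ (including a point mass) and define $$E_n^{\mathrm{RWS}}(\theta;\epsilon_n,T_n)=\left(\int_{\mathbb R}\exp\Big(\lambda S_n(\theta)-n(\hat s_n^2+\epsilon_n)\frac{\lambda^2}{2}\Big)\,dF(\lambda)\right)\wedge T_n .$$ Then $(E_n^{\mathrm{RWS}}(\theta;\epsilon_n,T_n))$ is an asymptotic e-variable for all distributions in $\mathcal M_{2+\delta}(\theta)$, i.e. $\limsup_{n\to\infty}\mathbb E_P[E_n^{\mathrm{RWS}}(\theta;\epsilon_n,T_n)]\le1$ for every $P\in\mathcal M_{2+\delta}(\theta)$. Moreover, if $\mathcal P\subseteq\mathcal M_{2+\delta}(\theta)$ and $(X_n)$ has a $\mathcal P$-uniformly bounded $(2+\delta)$-th moment, then it is a $\mathcal P$-uniform asymptotic e-variable, i.e. $\limsup_{n\to\infty}\sup_{P\in\mathcal P}\mathbb E_P[E_n^{\mathrm{RWS}}(\theta;\epsilon_n,T_n)]\le1$.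
   Context: Under $P$, $X_1,X_2,\dots$ are iid with law $P$. $S_n(\theta)=\sum_{i\le n}(X_i-\theta)$, $\overline X_n=n^{-1}\sum_{i\le n}X_i$, $\hat s_n^2=n^{-1}\sum_{i\le n}(X_i-\overline X_n)^2$, and $a\wedge b=\min(a,b)$. $\mathcal M_q(\theta)$ is the set of distributions $P$ on $\mathbb R$ with mean $\theta$ and $\mathbb E_P|X_1-\theta|^q<\infty$. $\mathcal P$-uniformly bounded $q$-th moment means $\sup_{P\in\mathcal P}\mathbb E_P|X_1|^q<\infty$. *)

theory Defs
  imports "HOL-Probability.Probability"
begin

(* Sequences of observations are indexed from 0, so the first n observations
   X_1, ..., X_n are X 0, ..., X (n - 1).  Expectations of
   [0,\<infinity>]-valued quantities are non-negative Lebesgue integrals in ennreal. *)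

definition moment_class :: "real \<Rightarrow> real \<Rightarrow> real measure set" where
  "moment_class q \<theta> =
     {P. real_distribution P \<and> integrable P (\<lambda>x. x) \<and> (\<integral>x. x \<partial>P) = \<theta> \<and>
         (\<integral>\<^sup>+x. ennreal (\<bar>x - \<theta>\<bar> powr q) \<partial>P) < \<infinity>}"

definition iid_with_law :: "'w measure \<Rightarrow> (nat \<Rightarrow> 'w \<Rightarrow> real) \<Rightarrow> real measure \<Rightarrow> bool" where
  "iid_with_law M X P \<longleftrightarrow>
     prob_space M \<and> prob_space.indep_vars M (\<lambda>_. borel) X UNIV \<and>
     (\<forall>i. distr M borel (X i) = P)"

definition centered_sum :: "(nat \<Rightarrow> 'w \<Rightarrow> real) \<Rightarrow> real \<Rightarrow> nat \<Rightarrow> 'w \<Rightarrow> real" where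
  "centered_sum X \<theta> n \<omega> = (\<Sum>i<n. (X i \<omega> - \<theta>))"

definition sample_mean :: "(nat \<Rightarrow> 'w \<Rightarrow> real) \<Rightarrow> nat \<Rightarrow> 'w \<Rightarrow> real" where
  "sample_mean X n \<omega> = (\<Sum>i<n. X i \<omega>) / real n"

definition sample_variance :: "(nat \<Rightarrow> 'w \<Rightarrow> real) \<Rightarrow> nat \<Rightarrow> 'w \<Rightarrow> real" where
  "sample_variance X n \<omega> = (\<Sum>i<n. (X i \<omega> - sample_mean X n \<omega>)\<^sup>2) / real n"

(* The mixture integral can be infinite, so it is taken in ennreal before the
   truncation at T n. *)
definition rws_e_variable ::
  "(nat \<Rightarrow> 'w \<Rightarrow> real) \<Rightarrow> real measure \<Rightarrow> real \<Rightarrow> (nat \<Rightarrow> real) \<Rightarrow> (nat \<Rightarrow> real)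
     \<Rightarrow> nat \<Rightarrow> 'w \<Rightarrow> ennreal" where
  "rws_e_variable X F \<theta> \<epsilon> T n \<omega> =
     min (\<integral>\<^sup>+l. ennreal (exp (l * centered_sum X \<theta> n \<omega>
                               - real n * (sample_variance X n \<omega> + \<epsilon> n) * (l\<^sup>2 / 2))) \<partial>F)
         (ennreal (T n))"

(* In the following, Pr P is the probability measure on the sample space under
   which the observations have law P.  Measurability is required explicitly
   since the non-negative integral is also defined for non-measurable functions. *)

definition asymptotic_e_variable ::
  "(real measure \<Rightarrow> 'w measure) \<Rightarrow> real measure set \<Rightarrow> (nat \<Rightarrow> 'w \<Rightarrow> ennreal) \<Rightarrow> bool" where
  "asymptotic_e_variable Pr \<P> E \<longleftrightarrow>
     (\<forall>P\<in>\<P>. \<forall>n. E n \<in> borel_measurable (Pr P)) \<and>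
     (\<forall>P\<in>\<P>. limsup (\<lambda>n. \<integral>\<^sup>+\<omega>. E n \<omega> \<partial>Pr P) \<le> 1)"

definition uniform_asymptotic_e_variable ::
  "(real measure \<Rightarrow> 'w measure) \<Rightarrow> real measure set \<Rightarrow> (nat \<Rightarrow> 'w \<Rightarrow> ennreal) \<Rightarrow> bool" where
  "uniform_asymptotic_e_variable Pr \<P> E \<longleftrightarrow>
     (\<forall>P\<in>\<P>. \<forall>n. E n \<in> borel_measurable (Pr P)) \<and>
     limsup (\<lambda>n. SUP P\<in>\<P>. \<integral>\<^sup>+\<omega>. E n \<omega> \<partial>Pr P) \<le> 1"

definition uniformly_bounded_moment ::
  "(real measure \<Rightarrow> 'w measure) \<Rightarrow> real measure set \<Rightarrow> real \<Rightarrow> (nat \<Rightarrow> 'w \<Rightarrow> real) \<Rightarrow> bool" where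
  "uniformly_bounded_moment Pr \<P> q X \<longleftrightarrow>
     (SUP P\<in>\<P>. \<integral>\<^sup>+\<omega>. ennreal (\<bar>X 0 \<omega>\<bar> powr q) \<partial>Pr P) < \<infinity>"

end

theory Submission
  imports Defs "HOL-Real_Asymp.Real_Asymp"
begin

text \<open>
  Write \<open>Y i = X i - \<theta>\<close>, \<open>S\<close> for the sum and \<open>V\<close> for the sum of squares of the first \<open>n\<close> of the
  \<open>Y i\<close>, and \<open>m p\<close> for the absolute centered moment of order \<open>p\<close>.  Since \<open>n\<close> times the sample
  variance is \<open>V - S\<^sup>2/n\<close>, the exponent in the mixture is a concave quadratic in \<open>l\<close> that vanishes
  at \<open>l = 0\<close>, and on the event \<open>S\<^sup>2 \<le> n\<^sup>2 \<epsilon>/4\<close> it is at most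
  \<open>l S - l\<^sup>2 V/2 - (3/8) n \<epsilon> l\<^sup>2\<close>.

  The function \<open>exp (x - x\<^sup>2/2)\<close> has no quadratic term at 0, so the expectation of
  \<open>exp (l S - l\<^sup>2 V/2)\<close> is at most \<open>exp (n |l| powr (2 + d) m (2 + d))\<close> for \<open>0 \<le> d \<le> 1\<close>.  Choose a
  threshold \<open>L\<close> with \<open>L\<^sup>d m (2 + d) \<le> \<epsilon>/4\<close>.  For \<open>|l| \<le> L\<close> the
  penalty \<open>\<epsilon>\<close> absorbs this error, and the integrand has expectation at most 1.  For \<open>|l| > L\<close>
  concavity helps: if the integrand is at most 1 at \<open>L\<close> and at \<open>-L\<close>, then it is at most 1
  beyond.  Hence the expectation of the truncated mixture is at most \<open>1 + T\<close> times the
  probability of a bad event (lemma \<open>nn_integral_rws_le\<close>).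

  The bad event has three parts.
  \<^item> The integrand exceeds 1 at \<open>L\<close> or \<open>-L\<close> while \<open>S\<close> is moderate.  Evaluating the exponential bound at \<open>L/2\<close>
    instead of \<open>L\<close> leaves a strictly negative quadratic term, and the probability is at most
    \<open>2 exp (- n L\<^sup>2 (m 2 + \<epsilon>)/16)\<close> (lemma \<open>threshold_tail_bound\<close>).
  \<^item> \<open>S\<close> is large although \<open>V \<le> n v\<close>; this has probability at most \<open>2 exp (- n \<epsilon>/(24 v))\<close>
    by self-normalization (lemma \<open>self_normalized_tail_bound\<close>).
  \<^item> \<open>V \<ge> n v\<close>; this is the only part of polynomial size, \<open>O(v powr - (1 + \<delta>/2))\<close>, by
    convexity and the moment of order \<open>2 + \<delta>\<close> (lemma \<open>square_sum_tail_bound\<close>).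

  Because \<open>T\<close> diverges, the rate condition forces \<open>\<epsilon> \<ge> n powr - (\<delta> \<gamma>/(4 + \<delta>))\<close> eventually.  With
  \<open>v\<close> of order \<open>n powr (\<delta> \<gamma>/(2 + \<delta>))\<close> the last probability is at most \<open>n powr - (\<delta> \<gamma>/2)\<close>, which \<open>T\<close>
  cannot compensate, and both exponents are at least a constant times \<open>n powr (1 - 2 \<gamma>)\<close>.  This is where
  \<open>\<gamma> < 1/2\<close> enters.  All constants depend on the law only through a bound for its moment
  of order \<open>2 + \<delta>\<close>, so the pointwise and the uniform claim have the same proof.
\<close>

section \<open>Exponential inequalities for one observation\<close>

text \<open>The expansion at 0 is \<open>1 + x - x\<^sup>3/3 + ...\<close>, which explains an error of order 3; far from 0 the
  left side is bounded, so a quadratic error is enough there, and \<open>|x| powr (2 + d)\<close> dominates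
  whichever of the two is smaller.  For \<open>x \<ge> 0\<close> even \<open>1 + x\<close> is an upper bound.\<close>
lemma exp_linear_minus_half_square_le:
  fixes x d :: real
  assumes "0 \<le> d" "d \<le> 1"
  shows "exp (x - x\<^sup>2 / 2) \<le> 1 + x + \<bar>x\<bar> powr (2 + d)"
proof (cases "0 \<le> x")
  case True
  have "(\<lambda>y. ln (1 + y) - (y - y\<^sup>2 / 2)) 0 \<le> (\<lambda>y. ln (1 + y) - (y - y\<^sup>2 / 2)) x"
  proof (rule DERIV_nonneg_imp_nondecreasing[OF True])
    fix y :: real assume y: "0 \<le> y" "y \<le> x"
    have "((\<lambda>y. ln (1 + y) - (y - y\<^sup>2 / 2)) has_real_derivative 1 / (1 + y) - (1 - y)) (at y)"
      using y by (auto intro!: derivative_eq_intros)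
    moreover have "1 / (1 + y) - (1 - y) = y\<^sup>2 / (1 + y)"
      using y by (simp add: field_simps power2_eq_square)
    ultimately show "\<exists>z. ((\<lambda>y. ln (1 + y) - (y - y\<^sup>2 / 2)) has_real_derivative z) (at y) \<and> 0 \<le> z"
      using y by (metis add_nonneg_nonneg divide_nonneg_nonneg zero_le_one zero_le_power2)
  qed
  then have "exp (x - x\<^sup>2 / 2) \<le> exp (ln (1 + x))" by simp
  also have "\<dots> = 1 + x" using True by simp
  finally show ?thesis by (smt (verit) powr_ge_zero)
next
  case False
  define u where "u = - x"
  have u: "0 < u" using False by (simp add: u_def)
  have x: "x = - u" by (simp add: u_def)
  \<comment> \<open>The claim is inverted: a lower bound for \<open>exp (u + u\<^sup>2/2)\<close> is multiplied with the
    candidate upper bound, and the product is a polynomial that is visibly at least 1.\<close>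
  have "1 + (u + u\<^sup>2 / 2) + (u + u\<^sup>2 / 2)\<^sup>2 / 2 \<le> exp (u + u\<^sup>2 / 2)"
    using u by (intro exp_lower_Taylor_quadratic) auto
  moreover have "(u + u\<^sup>2 / 2)\<^sup>2 \<ge> u\<^sup>2"
    using u by (intro power_mono) auto
  ultimately have low: "1 + u + u\<^sup>2 \<le> exp (u + u\<^sup>2 / 2)" by simp
  have *: "exp (- u - u\<^sup>2 / 2) \<le> 1 - u + w" if w: "1 \<le> (1 + u + u\<^sup>2) * (1 - u + w)" for w
  proof -
    have "0 < 1 + u + u\<^sup>2" using u by (simp add: add_pos_pos)
    then have "0 \<le> 1 - u + w" using w by (smt (verit) mult_pos_neg)
    then have "1 \<le> exp (u + u\<^sup>2 / 2) * (1 - u + w)"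
      using w low by (smt (verit) mult_right_mono)
    then have "exp (- (u + u\<^sup>2 / 2)) * 1 \<le> exp (- (u + u\<^sup>2 / 2)) * (exp (u + u\<^sup>2 / 2) * (1 - u + w))"
      by (intro mult_left_mono) auto
    also have "\<dots> = 1 - u + w" by (simp add: mult.assoc[symmetric] exp_add[symmetric])
    finally show ?thesis by (simp add: algebra_simps)
  qed
  show ?thesis
  proof (cases "u \<le> 1")
    case True
    have "u powr 3 \<le> u powr (2 + d)" using u True assms by (intro powr_mono') auto
    moreover have "u powr 3 = u ^ 3" using u powr_realpow[of u 3] by simp
    moreover have "exp (- u - u\<^sup>2 / 2) \<le> 1 - u + u ^ 3"
    proof (rule *)
      have "(1 + u + u\<^sup>2) * (1 - u + u ^ 3) = 1 + u ^ 4 + u ^ 5" by algebra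
      then show "1 \<le> (1 + u + u\<^sup>2) * (1 - u + u ^ 3)" using u by simp
    qed
    ultimately show ?thesis using u by (simp add: x)
  next
    case False
    have "u powr 2 \<le> u powr (2 + d)" using u False assms by (intro powr_mono) auto
    moreover have "u powr 2 = u ^ 2" using u powr_realpow[of u 2] by simp
    moreover have "exp (- u - u\<^sup>2 / 2) \<le> 1 - u + u ^ 2"
    proof (rule *)
      have "(1 + u + u\<^sup>2) * (1 - u + u ^ 2) = 1 + u ^ 2 + u ^ 4" by algebra
      then show "1 \<le> (1 + u + u\<^sup>2) * (1 - u + u ^ 2)" using u by simp
    qed
    ultimately show ?thesis using u by (simp add: x)
  qed
qed

text \<open>Doubling the quadratic penalty gains the term \<open>- x\<^sup>2/2\<close>.  Near 0 this follows from the
  previous lemma after multiplication with \<open>exp (- x\<^sup>2/2) \<le> 1 / (1 + x\<^sup>2/2)\<close>.\<close>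
lemma exp_linear_minus_square_le:
  fixes x d :: real
  assumes d: "0 \<le> d" "d \<le> 1"
  shows "exp (x - x\<^sup>2) \<le> 1 + x - x\<^sup>2 / 2 + 2 * \<bar>x\<bar> powr (2 + d)"
proof (cases "\<bar>x\<bar> \<le> 1")
  case True
  have "1 + x\<^sup>2 / 2 \<le> exp (x\<^sup>2 / 2)" by (rule exp_ge_add_one_self)
  then have "exp (- (x\<^sup>2 / 2)) \<le> 1 / (1 + x\<^sup>2 / 2)"
    by (simp add: exp_minus divide_simps add_pos_nonneg)
  define p where "p = \<bar>x\<bar> powr (2 + d)"
  have "\<bar>x\<bar> powr 3 \<le> p" unfolding p_def using True d by (intro powr_mono') auto
  then have p: "\<bar>x\<bar>^3 \<le> p" "0 \<le> p" using powr_realpow[of "\<bar>x\<bar>" 3] by (cases "x = 0"; simp add: p_def)+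
  have "x * x\<^sup>2 = x^3" by (simp add: power2_eq_square power3_eq_cube)
  have "exp (x - x\<^sup>2) = exp (x - x\<^sup>2 / 2) * exp (- (x\<^sup>2 / 2))" by (simp add: exp_add[symmetric])
  also have "\<dots> \<le> (1 + x + p) * (1 / (1 + x\<^sup>2 / 2))"
    using exp_linear_minus_half_square_le[OF d, of x] \<open>exp (- (x\<^sup>2 / 2)) \<le> 1 / (1 + x\<^sup>2 / 2)\<close>
    unfolding p_def by (intro mult_mono) (auto, smt (verit) exp_ge_zero)
  also have "\<dots> \<le> 1 + x - x\<^sup>2 / 2 + 2 * p"
  proof -
    have "\<bar>x\<bar>^4 \<le> \<bar>x\<bar>^3" using True by (intro power_decreasing) auto
    have "(1 + x - x\<^sup>2 / 2 + 2 * p) * (1 + x\<^sup>2 / 2) = 1 + x + p + (p + x^3/2 - x^4/4 + p * x\<^sup>2)"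
      by (simp add: field_simps) algebra
    moreover have "0 \<le> p + x^3/2 - x^4/4 + p * x\<^sup>2"
    proof -
      have "\<bar>x^3\<bar> \<le> p" "x^4 \<le> p" using p \<open>\<bar>x\<bar>^4 \<le> \<bar>x\<bar>^3\<close> by (auto simp: power_abs)
      moreover have "0 \<le> p * x\<^sup>2" using p by simp
      ultimately show ?thesis by (simp add: abs_le_iff)
    qed
    ultimately have "1 + x + p \<le> (1 + x - x\<^sup>2 / 2 + 2 * p) * (1 + x\<^sup>2 / 2)" by linarith
    then show ?thesis by (simp add: pos_divide_le_eq add_pos_nonneg)
  qed
  finally show ?thesis unfolding p_def .
next
  case False
  have "\<bar>x\<bar> powr 2 \<le> \<bar>x\<bar> powr (2 + d)" using False d by (intro powr_mono) auto
  then have "x\<^sup>2 \<le> \<bar>x\<bar> powr (2 + d)" using False powr_realpow[of "\<bar>x\<bar>" 2] by simp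
  moreover have "\<bar>x\<bar> \<le> x\<^sup>2" using False mult_mono[of 1 "\<bar>x\<bar>" "\<bar>x\<bar>" "\<bar>x\<bar>"] by (simp add: power2_eq_square)
  moreover have "exp (x - x\<^sup>2) \<le> exp 0" using \<open>\<bar>x\<bar> \<le> x\<^sup>2\<close> by (subst exp_le_cancel_iff) linarith
  moreover have "0 \<le> x\<^sup>2" "- \<bar>x\<bar> \<le> x" by auto
  ultimately show ?thesis unfolding exp_zero by linarith
qed

section \<open>Exponential moments of self-normalized sums\<close>

definition centered_square_sum :: "(nat \<Rightarrow> 'w \<Rightarrow> real) \<Rightarrow> real \<Rightarrow> nat \<Rightarrow> 'w \<Rightarrow> real" where
  "centered_square_sum X \<theta> n \<omega> = (\<Sum>i<n. (X i \<omega> - \<theta>)\<^sup>2)"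

lemma sample_variance_eq:
  assumes "0 < n"
  shows "real n * sample_variance X n \<omega>
    = centered_square_sum X \<theta> n \<omega> - (centered_sum X \<theta> n \<omega>)\<^sup>2 / real n"
proof -
  define m where "m = sample_mean X n \<omega> - \<theta>"
  have S: "centered_sum X \<theta> n \<omega> = real n * m"
    using assms by (simp add: m_def centered_sum_def sample_mean_def sum_subtractf field_simps)
  have "(X i \<omega> - sample_mean X n \<omega>)\<^sup>2 = (X i \<omega> - \<theta>)\<^sup>2 - 2 * m * (X i \<omega> - \<theta>) + m\<^sup>2" for i
    unfolding m_def by (simp add: power2_eq_square algebra_simps)
  then have "real n * sample_variance X n \<omega>
      = centered_square_sum X \<theta> n \<omega> - 2 * m * centered_sum X \<theta> n \<omega> + real n * m\<^sup>2"
    using assms by (simp add: sample_variance_def centered_square_sum_def centered_sum_def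
      sum.distrib sum_subtractf[of "\<lambda>i. (X i \<omega> - \<theta>)\<^sup>2"] flip: sum_distrib_left)
  also have "\<dots> = centered_square_sum X \<theta> n \<omega> - (centered_sum X \<theta> n \<omega>)\<^sup>2 / real n"
    using assms by (simp add: S power2_eq_square field_simps)
  finally show ?thesis .
qed

locale iid_sample = prob_space M for M :: "'w measure" +
  fixes X :: "nat \<Rightarrow> 'w \<Rightarrow> real" and P :: "real measure" and \<theta> :: real
  assumes indep: "indep_vars (\<lambda>_. borel) X UNIV"
    and law: "\<And>i. distr M borel (X i) = P"
    and mean: "integrable P (\<lambda>x. x)" "(\<integral>x. x \<partial>P) = \<theta>"
begin

lemma measurable_X [measurable]: "X i \<in> borel_measurable M"
  using indep unfolding indep_vars_def2 by simp

lemma sets_P [measurable_cong, simp]: "sets P = sets borel"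
  using law[of 0] by (metis sets_distr)

lemma prob_space_P: "prob_space P"
  using law[of 0] prob_space_distr[of "X 0" borel] by simp

lemma measurable_centered_sum [measurable]: "centered_sum X \<theta> n \<in> borel_measurable M"
  unfolding centered_sum_def by measurable

lemma measurable_centered_square_sum [measurable]: "centered_square_sum X \<theta> n \<in> borel_measurable M"
  unfolding centered_square_sum_def by measurable

text \<open>A bound \<open>1 + l y + f y\<close> for one observation tensorizes: the linear term has mean zero,
  \<open>1 + z \<le> exp z\<close>, and independence turns the expectation into an \<open>n\<close>-th power.\<close>
lemma nn_integral_exp_quadratic_le:
  assumes le: "\<And>y. exp (l * y - c * y\<^sup>2) \<le> 1 + l * y + f y"
    and f: "integrable P (\<lambda>x. f (x - \<theta>))"
  shows "(\<integral>\<^sup>+\<omega>. ennreal (exp (l * centered_sum X \<theta> n \<omega> - c * centered_square_sum X \<theta> n \<omega>)) \<partial>M)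
    \<le> ennreal (exp (real n * (\<integral>x. f (x - \<theta>) \<partial>P)))"
proof -
  interpret P: prob_space P by (rule prob_space_P)
  define h where "h x = exp (l * (x - \<theta>) - c * (x - \<theta>)\<^sup>2)" for x
  have h[measurable]: "h \<in> borel_measurable borel" unfolding h_def by measurable
  have int: "integrable P (\<lambda>x. 1 + l * (x - \<theta>) + f (x - \<theta>))"
    using mean f by (intro Bochner_Integration.integrable_add integrable_mult_right Bochner_Integration.integrable_diff) auto
  have "(\<integral>\<^sup>+x. ennreal (h x) \<partial>P) \<le> (\<integral>\<^sup>+x. ennreal (1 + l * (x - \<theta>) + f (x - \<theta>)) \<partial>P)"
    unfolding h_def by (intro nn_integral_mono ennreal_leI le)
  also have "\<dots> = ennreal (\<integral>x. 1 + l * (x - \<theta>) + f (x - \<theta>) \<partial>P)"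
    using order_trans[OF exp_ge_zero le] by (intro nn_integral_eq_integral int AE_I2) auto
  also have "(\<integral>x. 1 + l * (x - \<theta>) + f (x - \<theta>) \<partial>P) = 1 + (\<integral>x. f (x - \<theta>) \<partial>P)"
    using mean f by (simp add: P.prob_space)
  also have "ennreal \<dots> \<le> ennreal (exp (\<integral>x. f (x - \<theta>) \<partial>P))"
    by (intro ennreal_leI exp_ge_add_one_self)
  finally have one: "(\<integral>\<^sup>+x. ennreal (h x) \<partial>P) \<le> ennreal (exp (\<integral>x. f (x - \<theta>) \<partial>P))" .
  have "(\<integral>\<^sup>+\<omega>. ennreal (exp (l * centered_sum X \<theta> n \<omega> - c * centered_square_sum X \<theta> n \<omega>)) \<partial>M)
      = (\<integral>\<^sup>+\<omega>. (\<Prod>i<n. ennreal (h (X i \<omega>))) \<partial>M)"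
    by (simp add: h_def centered_sum_def centered_square_sum_def sum_distrib_left prod_ennreal
      exp_sum flip: sum_subtractf)
  also have "\<dots> = (\<Prod>i<n. \<integral>\<^sup>+\<omega>. ennreal (h (X i \<omega>)) \<partial>M)"
  proof (rule indep_vars_nn_integral)
    show "indep_vars (\<lambda>_. borel) (\<lambda>i \<omega>. ennreal (h (X i \<omega>))) {..<n}"
      by (rule indep_vars_compose2[OF indep_vars_subset[OF indep]]) auto
  qed auto
  also have "\<dots> = (\<Prod>i<n. \<integral>\<^sup>+x. ennreal (h x) \<partial>P)"
    by (intro prod.cong refl, subst law[symmetric]) (simp add: nn_integral_distr)
  also have "\<dots> \<le> (ennreal (exp (\<integral>x. f (x - \<theta>) \<partial>P))) ^ n"
    using one by (simp add: power_mono)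
  also have "\<dots> = ennreal (exp (real n * (\<integral>x. f (x - \<theta>) \<partial>P)))"
    by (simp add: ennreal_power exp_of_nat_mult)
  finally show ?thesis .
qed

abbreviation moment :: "real \<Rightarrow> real" where
  "moment p \<equiv> (\<integral>x. \<bar>x - \<theta>\<bar> powr p \<partial>P)"

lemma integrable_lower_moment:
  assumes "integrable P (\<lambda>x. \<bar>x - \<theta>\<bar> powr q)" "0 \<le> p" "p \<le> q"
  shows "integrable P (\<lambda>x. \<bar>x - \<theta>\<bar> powr p)"
    and "moment p \<le> 1 + moment q"
proof -
  interpret P: prob_space P by (rule prob_space_P)
  have le: "\<bar>x - \<theta>\<bar> powr p \<le> 1 + \<bar>x - \<theta>\<bar> powr q" for x
  proof (cases "\<bar>x - \<theta>\<bar> \<le> 1")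
    case True
    then have "\<bar>x - \<theta>\<bar> powr p \<le> 1" using assms powr_mono2[of p "\<bar>x - \<theta>\<bar>" 1] by simp
    then show ?thesis by (smt (verit) powr_ge_zero)
  next
    case False
    then have "\<bar>x - \<theta>\<bar> powr p \<le> \<bar>x - \<theta>\<bar> powr q" using assms by (intro powr_mono) auto
    then show ?thesis by simp
  qed
  have int: "integrable P (\<lambda>x. 1 + \<bar>x - \<theta>\<bar> powr q)" using assms by simp
  show "integrable P (\<lambda>x. \<bar>x - \<theta>\<bar> powr p)"
    using le by (intro Bochner_Integration.integrable_bound[OF int]) auto
  then have "moment p \<le> (\<integral>x. 1 + \<bar>x - \<theta>\<bar> powr q \<partial>P)"
    using le by (intro integral_mono int) auto
  then show "moment p \<le> 1 + moment q" using assms by (simp add: P.prob_space)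
qed

lemma nn_integral_exp_half_square_le:
  assumes d: "0 \<le> d" "d \<le> 1" and int: "integrable P (\<lambda>x. \<bar>x - \<theta>\<bar> powr (2 + d))"
  shows "(\<integral>\<^sup>+\<omega>. ennreal (exp (l * centered_sum X \<theta> n \<omega> - l\<^sup>2 / 2 * centered_square_sum X \<theta> n \<omega>)) \<partial>M)
    \<le> ennreal (exp (real n * (\<bar>l\<bar> powr (2 + d) * moment (2 + d))))"
proof -
  have "(\<integral>\<^sup>+\<omega>. ennreal (exp (l * centered_sum X \<theta> n \<omega> - l\<^sup>2 / 2 * centered_square_sum X \<theta> n \<omega>)) \<partial>M)
    \<le> ennreal (exp (real n * (\<integral>x. \<bar>l\<bar> powr (2 + d) * \<bar>x - \<theta>\<bar> powr (2 + d) \<partial>P)))"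
    using exp_linear_minus_half_square_le[OF d, of "l * y" for y] int
    by (intro nn_integral_exp_quadratic_le) (auto simp: power_mult_distrib abs_mult powr_mult)
  then show ?thesis by simp
qed

text \<open>Compared with the previous lemma, the term with \<open>moment 2\<close> now helps.  It is what makes the
  threshold estimate strong enough when \<open>\<epsilon>\<close> decays almost like \<open>1 / sqrt n\<close>.\<close>
lemma nn_integral_exp_square_le:
  assumes d: "0 \<le> d" "d \<le> 1" and int: "integrable P (\<lambda>x. \<bar>x - \<theta>\<bar> powr (2 + d))"
  shows "(\<integral>\<^sup>+\<omega>. ennreal (exp (l * centered_sum X \<theta> n \<omega> - l\<^sup>2 * centered_square_sum X \<theta> n \<omega>)) \<partial>M)
    \<le> ennreal (exp (real n * (2 * \<bar>l\<bar> powr (2 + d) * moment (2 + d) - l\<^sup>2 / 2 * moment 2)))"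
proof -
  have int2: "integrable P (\<lambda>x. \<bar>x - \<theta>\<bar> powr 2)" using int d by (rule_tac integrable_lower_moment) auto
  have "exp (l * y - l\<^sup>2 * y\<^sup>2)
      \<le> 1 + l * y + (2 * \<bar>l\<bar> powr (2 + d) * \<bar>y\<bar> powr (2 + d) - l\<^sup>2 / 2 * \<bar>y\<bar> powr 2)" for y
    using exp_linear_minus_square_le[OF d, of "l * y"]
    by (simp add: power_mult_distrib abs_mult powr_mult)
  then have "(\<integral>\<^sup>+\<omega>. ennreal (exp (l * centered_sum X \<theta> n \<omega> - l\<^sup>2 * centered_square_sum X \<theta> n \<omega>)) \<partial>M)
    \<le> ennreal (exp (real n * (\<integral>x. 2 * \<bar>l\<bar> powr (2 + d) * \<bar>x - \<theta>\<bar> powr (2 + d)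
          - l\<^sup>2 / 2 * \<bar>x - \<theta>\<bar> powr 2 \<partial>P)))"
    using int int2 by (intro nn_integral_exp_quadratic_le) auto
  then show ?thesis using int int2 by simp
qed


section \<open>Tail bounds\<close>

lemma chernoff_bound:
  fixes g :: "'w \<Rightarrow> real"
  assumes [measurable]: "g \<in> borel_measurable M"
    and le: "(\<integral>\<^sup>+\<omega>. ennreal (exp (g \<omega>)) \<partial>M) \<le> ennreal (exp b)"
  shows "prob {\<omega>\<in>space M. a \<le> g \<omega>} \<le> exp (b - a)"
proof -
  have "ennreal (prob {\<omega>\<in>space M. a \<le> g \<omega>})
      = (\<integral>\<^sup>+\<omega>. indicator {\<omega>\<in>space M. a \<le> g \<omega>} \<omega> \<partial>M)"
    by (simp add: emeasure_eq_measure)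
  also have "\<dots> \<le> (\<integral>\<^sup>+\<omega>. ennreal (exp (- a)) * ennreal (exp (g \<omega>)) \<partial>M)"
    by (intro nn_integral_mono)
      (auto simp: indicator_def ennreal_mult[symmetric] exp_add[symmetric])
  also have "\<dots> = ennreal (exp (- a)) * (\<integral>\<^sup>+\<omega>. ennreal (exp (g \<omega>)) \<partial>M)"
    by (rule nn_integral_cmult) measurable
  also have "\<dots> \<le> ennreal (exp (- a)) * ennreal (exp b)"
    by (intro mult_left_mono le) auto
  also have "\<dots> = ennreal (exp (b - a))"
    by (simp add: ennreal_mult[symmetric] exp_add[symmetric])
  finally show ?thesis by simp
qed

text \<open>Restricting to \<open>V \<le> n v\<close> gives a sub-Gaussian bound under a second moment alone: use
  the exponential moment with \<open>d = 0\<close> at \<open>l = t / (3 v)\<close>, which minimizes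
  \<open>n (3 l\<^sup>2 v / 2 - l t)\<close>.\<close>
lemma self_normalized_tail_bound:
  assumes int: "integrable P (\<lambda>x. \<bar>x - \<theta>\<bar> powr 2)"
    and v: "0 < v" "moment 2 \<le> v" and t: "0 < t"
  shows "prob {\<omega>\<in>space M. real n * t \<le> \<bar>centered_sum X \<theta> n \<omega>\<bar> \<and> centered_square_sum X \<theta> n \<omega> \<le> real n * v}
    \<le> 2 * exp (- (real n * t\<^sup>2 / (6 * v)))"
proof -
  let ?S = "centered_sum X \<theta> n" and ?V = "centered_square_sum X \<theta> n"
  define l where "l = t / (3 * v)"
  have l: "0 < l" using v t by (simp add: l_def)
  define a where "a = l * (real n * t) - l\<^sup>2 / 2 * (real n * v)"
  define H where "H k = {\<omega>\<in>space M. a \<le> k * ?S \<omega> - k\<^sup>2 / 2 * ?V \<omega>}" for k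
  have H[measurable]: "H k \<in> sets M" for k unfolding H_def by measurable
  have tail: "prob (H k) \<le> exp (- (real n * t\<^sup>2 / (6 * v)))" if k: "\<bar>k\<bar> = l" for k
  proof -
    have "prob (H k) \<le> exp (real n * (\<bar>k\<bar> powr (2 + 0) * moment (2 + 0)) - a)"
      unfolding H_def using int by (intro chernoff_bound nn_integral_exp_half_square_le) auto
    also have "\<dots> \<le> exp (real n * (l\<^sup>2 * v) - a)"
      using k l v by (simp add: mult_left_mono)
    also have "real n * (l\<^sup>2 * v) - a = - (real n * t\<^sup>2 / (6 * v))"
      using v by (simp add: a_def l_def power2_eq_square field_simps)
    finally show ?thesis .
  qed
  have "{\<omega>\<in>space M. real n * t \<le> \<bar>?S \<omega>\<bar> \<and> ?V \<omega> \<le> real n * v} \<subseteq> H l \<union> H (- l)"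
  proof safe
    fix \<omega> assume \<omega>: "\<omega> \<in> space M" "real n * t \<le> \<bar>?S \<omega>\<bar>" "?V \<omega> \<le> real n * v" "\<omega> \<notin> H (- l)"
    have "l * (real n * t) \<le> l * \<bar>?S \<omega>\<bar>" "l\<^sup>2 / 2 * ?V \<omega> \<le> l\<^sup>2 / 2 * (real n * v)"
      using \<omega> l by (auto intro!: mult_left_mono)
    then have "a \<le> l * \<bar>?S \<omega>\<bar> - l\<^sup>2 / 2 * ?V \<omega>" unfolding a_def by linarith
    then show "\<omega> \<in> H l" using \<omega> unfolding H_def by (cases "0 \<le> ?S \<omega>") auto
  qed
  then have "prob {\<omega>\<in>space M. real n * t \<le> \<bar>?S \<omega>\<bar> \<and> ?V \<omega> \<le> real n * v} \<le> prob (H l \<union> H (- l))"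
    by (intro finite_measure_mono) auto
  also have "\<dots> \<le> prob (H l) + prob (H (- l))" by (intro measure_Un_le) auto
  also have "\<dots> \<le> 2 * exp (- (real n * t\<^sup>2 / (6 * v)))"
    using tail[of l] tail[of "- l"] l by simp
  finally show ?thesis .
qed

text \<open>Markov's inequality for \<open>(V / n) powr p\<close>, which Jensen's inequality bounds by the
  average of the \<open>|Y i| powr (2 p)\<close>.\<close>
lemma square_sum_tail_bound:
  assumes p: "1 \<le> p" and int: "integrable P (\<lambda>x. \<bar>x - \<theta>\<bar> powr (2 * p))"
    and n: "0 < n" and v: "0 < v"
  shows "prob {\<omega>\<in>space M. real n * v \<le> centered_square_sum X \<theta> n \<omega>}
    \<le> (1 + moment (2 * p)) / v powr p"
proof -
  let ?V = "centered_square_sum X \<theta> n"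
  define W where "W \<omega> = (\<Sum>i<n. (1 / real n) * (1 + \<bar>X i \<omega> - \<theta>\<bar> powr (2 * p)))" for \<omega>
  have intM: "integrable M (\<lambda>\<omega>. \<bar>X i \<omega> - \<theta>\<bar> powr (2 * p))"
    and exM: "(\<integral>\<omega>. \<bar>X i \<omega> - \<theta>\<bar> powr (2 * p) \<partial>M) = moment (2 * p)" for i
  proof -
    show "integrable M (\<lambda>\<omega>. \<bar>X i \<omega> - \<theta>\<bar> powr (2 * p))"
      using int unfolding law[of i, symmetric] by (subst (asm) integrable_distr_eq) auto
    show "(\<integral>\<omega>. \<bar>X i \<omega> - \<theta>\<bar> powr (2 * p) \<partial>M) = moment (2 * p)"
      unfolding law[of i, symmetric] by (subst integral_distr) auto
  qed
  have intW: "integrable M W" unfolding W_def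
    by (intro Bochner_Integration.integrable_sum integrable_mult_right
        Bochner_Integration.integrable_add intM) auto
  have exW: "expectation W = 1 + moment (2 * p)"
    unfolding W_def using n intM exM by (simp add: Bochner_Integration.integral_sum prob_space field_simps)
  have jensen: "(?V \<omega> / real n) powr p \<le> W \<omega>" for \<omega>
  proof -
    \<comment> \<open>Convexity of \<open>x powr p\<close> is used on the positive half-line, so the squares are
      first raised to at least 1; this costs the summand 1 in the definition of \<open>W\<close>.\<close>
    define z where "z i = max 1 ((X i \<omega> - \<theta>)\<^sup>2)" for i
    have "?V \<omega> / real n = (\<Sum>i<n. (1 / real n) * (X i \<omega> - \<theta>)\<^sup>2)"
      by (simp add: centered_square_sum_def sum_divide_distrib)
    also have "\<dots> \<le> (\<Sum>i<n. (1 / real n) * z i)"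
      by (intro sum_mono mult_left_mono) (auto simp: z_def)
    finally have "(?V \<omega> / real n) powr p \<le> (\<Sum>i<n. (1 / real n) * z i) powr p"
      using p by (intro powr_mono2) (auto simp: centered_square_sum_def sum_nonneg)
    also have "\<dots> \<le> (\<Sum>i<n. (1 / real n) * (z i powr p))"
      using convex_on_sum[of "{..<n}" "{0<..}" "\<lambda>x. x powr p" "\<lambda>_. 1 / real n" z] n powr_convex[OF p]
      by (auto simp: z_def lessThan_empty_iff)
    also have "\<dots> \<le> W \<omega>" unfolding W_def
    proof (intro sum_mono mult_left_mono)
      fix i
      have "(X i \<omega> - \<theta>)\<^sup>2 powr p = \<bar>X i \<omega> - \<theta>\<bar> powr (2 * p)"
        using powr_powr[of "\<bar>X i \<omega> - \<theta>\<bar>" 2 p] by (simp add: powr_powr)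
      then show "z i powr p \<le> 1 + \<bar>X i \<omega> - \<theta>\<bar> powr (2 * p)"
        by (auto simp: z_def max_def)
    qed simp
    finally show ?thesis .
  qed
  have "prob {\<omega>\<in>space M. real n * v \<le> ?V \<omega>} \<le> prob {\<omega>\<in>space M. v powr p \<le> W \<omega>}"
  proof (intro finite_measure_mono subsetI)
    fix \<omega> assume "\<omega> \<in> {\<omega>\<in>space M. real n * v \<le> ?V \<omega>}"
    then have "v powr p \<le> (?V \<omega> / real n) powr p" "\<omega> \<in> space M"
      using n v p by (auto intro!: powr_mono2 simp: field_simps)
    then show "\<omega> \<in> {\<omega>\<in>space M. v powr p \<le> W \<omega>}" using jensen[of \<omega>] by auto
  next
    have [measurable]: "W \<in> borel_measurable M" using intW by auto
    show "{\<omega>\<in>space M. v powr p \<le> W \<omega>} \<in> events" by measurable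
  qed
  also have "\<dots> \<le> expectation W / v powr p"
  proof (rule integral_Markov_inequality_measure[of _ _ "{}"])
    show "AE \<omega> in M. 0 \<le> W \<omega>" unfolding W_def by (intro AE_I2 sum_nonneg) auto
  qed (use v intW in auto)
  finally show ?thesis by (simp add: exW)
qed

text \<open>Halving the inequality that defines the event and putting \<open>k = l / 2\<close> turns its right side
  into \<open>k S - k\<^sup>2 V\<close>, where the exponential moment has the extra factor
  \<open>exp (- n k\<^sup>2 moment 2 / 2)\<close>.  The condition on \<open>l\<close> keeps the error term below two thirds
  of the penalty.\<close>
lemma threshold_tail_bound:
  assumes d: "0 \<le> d" "d \<le> 1" and int: "integrable P (\<lambda>x. \<bar>x - \<theta>\<bar> powr (2 + d))"
    and l: "l \<noteq> 0" "\<bar>l\<bar> powr d * moment (2 + d) \<le> e / 4" and e: "0 \<le> e"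
  shows "prob {\<omega>\<in>space M. 3 / 8 * real n * e * l\<^sup>2
      \<le> l * centered_sum X \<theta> n \<omega> - l\<^sup>2 / 2 * centered_square_sum X \<theta> n \<omega>}
    \<le> exp (- (real n * (l\<^sup>2 * (moment 2 + e)) / 16))"
proof -
  let ?S = "centered_sum X \<theta> n" and ?V = "centered_square_sum X \<theta> n"
  define k where "k = l / 2"
  have "prob {\<omega>\<in>space M. 3 / 8 * real n * e * l\<^sup>2 \<le> l * ?S \<omega> - l\<^sup>2 / 2 * ?V \<omega>}
      = prob {\<omega>\<in>space M. 3 / 4 * real n * e * k\<^sup>2 \<le> k * ?S \<omega> - k\<^sup>2 * ?V \<omega>}"
  proof -
    have l: "l = 2 * k" "l\<^sup>2 = 4 * k\<^sup>2" by (simp_all add: k_def power2_eq_square)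
    have "3 / 8 * real n * e * l\<^sup>2 = 2 * (3 / 4 * real n * e * k\<^sup>2)"
      unfolding l(2) by simp
    moreover have "l * ?S \<omega> - l\<^sup>2 / 2 * ?V \<omega> = 2 * (k * ?S \<omega> - k\<^sup>2 * ?V \<omega>)" for \<omega>
      unfolding l(2) unfolding l(1) by (simp add: right_diff_distrib mult.assoc)
    ultimately show ?thesis by (simp only: mult_le_cancel_left_pos zero_less_numeral)
  qed
  also have "\<dots> \<le> exp (real n * (2 * \<bar>k\<bar> powr (2 + d) * moment (2 + d) - k\<^sup>2 / 2 * moment 2)
      - 3 / 4 * real n * e * k\<^sup>2)"
    by (rule chernoff_bound[OF _ nn_integral_exp_square_le[OF d int]]) measurable
  also have "\<dots> \<le> exp (- (real n * (l\<^sup>2 * (moment 2 + e)) / 16))"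
  proof -
    have "\<bar>k\<bar> powr d \<le> \<bar>l\<bar> powr d"
      using d by (intro powr_mono2) (auto simp: k_def)
    moreover have "0 \<le> moment (2 + d)" by (rule integral_nonneg_AE) auto
    ultimately have "\<bar>k\<bar> powr d * moment (2 + d) \<le> \<bar>l\<bar> powr d * moment (2 + d)"
      by (rule mult_right_mono)
    then have "\<bar>k\<bar> powr d * moment (2 + d) \<le> e / 4" using l by linarith
    then have "k\<^sup>2 * (\<bar>k\<bar> powr d * moment (2 + d)) \<le> k\<^sup>2 * (e / 4)" by (rule mult_left_mono) simp
    moreover have "\<bar>k\<bar> powr (2 + d) = k\<^sup>2 * \<bar>k\<bar> powr d" using l by (simp add: powr_add k_def power_divide)
    ultimately have A: "2 * \<bar>k\<bar> powr (2 + d) * moment (2 + d) \<le> k\<^sup>2 * e / 2"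
      by (simp add: algebra_simps)
    define w where "w = 2 * \<bar>k\<bar> powr (2 + d) * moment (2 + d)"
    define s where "s = moment 2"
    have "0 \<le> s" unfolding s_def by (rule integral_nonneg_AE) auto
    then have "0 \<le> k\<^sup>2 * s" by simp
    moreover have "w \<le> k\<^sup>2 * e / 2" using A unfolding w_def .
    moreover have "l\<^sup>2 * (s + e) / 16 = k\<^sup>2 * s / 4 + k\<^sup>2 * e / 4"
      by (simp add: k_def power_divide field_simps)
    moreover have "3 / 4 * e * k\<^sup>2 = 3 * (k\<^sup>2 * e) / 4" "k\<^sup>2 / 2 * s = k\<^sup>2 * s / 2" by simp_all
    ultimately have "w - k\<^sup>2 / 2 * s - 3 / 4 * e * k\<^sup>2 \<le> - (l\<^sup>2 * (s + e) / 16)"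
      by linarith
    then have "2 * \<bar>k\<bar> powr (2 + d) * moment (2 + d) - k\<^sup>2 / 2 * moment 2 - 3 / 4 * e * k\<^sup>2
        \<le> - (l\<^sup>2 * (moment 2 + e) / 16)" unfolding w_def s_def .
    then have "real n * (2 * \<bar>k\<bar> powr (2 + d) * moment (2 + d) - k\<^sup>2 / 2 * moment 2 - 3 / 4 * e * k\<^sup>2)
        \<le> real n * (- (l\<^sup>2 * (moment 2 + e) / 16))" by (intro mult_left_mono) auto
    then show ?thesis by (simp add: algebra_simps)
  qed
  finally show ?thesis .
qed


section \<open>Bounding the truncated mixture by a tail probability\<close>

lemma measurable_rws_e_variable:
  assumes F: "real_distribution F"
  shows "rws_e_variable X F \<theta> \<epsilon> T n \<in> borel_measurable M"
proof -
  interpret F: real_distribution F by fact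
  show ?thesis
    unfolding rws_e_variable_def[abs_def] sample_variance_def sample_mean_def by measurable
qed

text \<open>Outside \<open>bad\<close> the mixture is dominated by the mixture of \<open>h l\<close>, which is the exponential of
  \<open>g l\<close> up to the threshold and constantly 1 beyond it, and each \<open>h l\<close> has expectation
  at most 1 by the choice of \<open>L\<close>.  On \<open>bad\<close> the truncation at \<open>T n\<close> is used.\<close>
lemma nn_integral_rws_le:
  assumes F: "real_distribution F" and n: "0 < n" and T: "0 \<le> T n"
    and d: "0 \<le> d" "d \<le> 1" and int: "integrable P (\<lambda>x. \<bar>x - \<theta>\<bar> powr (2 + d))"
    and L: "0 < L" "L powr d * moment (2 + d) \<le> \<epsilon> n / 4"
    and bad[measurable]: "bad \<in> events"
    and good: "\<And>\<omega>. \<omega> \<in> space M \<Longrightarrow> \<omega> \<notin> bad \<Longrightarrow>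
      (centered_sum X \<theta> n \<omega>)\<^sup>2 \<le> (real n)\<^sup>2 * (\<epsilon> n / 4) \<and>
      L * \<bar>centered_sum X \<theta> n \<omega>\<bar> - L\<^sup>2 / 2 * centered_square_sum X \<theta> n \<omega>
        \<le> 3 / 8 * real n * \<epsilon> n * L\<^sup>2"
  shows "(\<integral>\<^sup>+\<omega>. rws_e_variable X F \<theta> \<epsilon> T n \<omega> \<partial>M) \<le> 1 + ennreal (T n * prob bad)"
proof -
  interpret F: real_distribution F by fact
  interpret FM: pair_sigma_finite F M ..
  let ?S = "centered_sum X \<theta> n" and ?V = "centered_square_sum X \<theta> n"
  define g where "g l \<omega> = l * ?S \<omega> - l\<^sup>2 / 2 * ?V \<omega> - 3 / 8 * real n * \<epsilon> n * l\<^sup>2" for l \<omega>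
  define h where "h l \<omega> = (if \<bar>l\<bar> \<le> L then ennreal (exp (g l \<omega>)) else 1)" for l \<omega>
  have e: "0 \<le> \<epsilon> n"
  proof -
    have "0 \<le> L powr d * moment (2 + d)"
      by (intro mult_nonneg_nonneg integral_nonneg_AE) auto
    then show ?thesis using L by linarith
  qed
  have inside: "(\<integral>\<^sup>+\<omega>. h l \<omega> \<partial>M) \<le> 1" for l
  proof (cases "\<bar>l\<bar> \<le> L")
    case True
    have "\<bar>l\<bar> powr d \<le> L powr d" using True d by (intro powr_mono2) auto
    moreover have "0 \<le> moment (2 + d)" by (rule integral_nonneg_AE) auto
    ultimately have "\<bar>l\<bar> powr d * moment (2 + d) \<le> L powr d * moment (2 + d)"
      by (rule mult_right_mono)
    then have "\<bar>l\<bar> powr d * moment (2 + d) \<le> 3 / 8 * \<epsilon> n" using L e by linarith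
    then have "l\<^sup>2 * (\<bar>l\<bar> powr d * moment (2 + d)) \<le> l\<^sup>2 * (3 / 8 * \<epsilon> n)" by (rule mult_left_mono) simp
    moreover have "\<bar>l\<bar> powr (2 + d) = l\<^sup>2 * \<bar>l\<bar> powr d" by (simp add: powr_add)
    ultimately have "\<bar>l\<bar> powr (2 + d) * moment (2 + d) \<le> 3 / 8 * \<epsilon> n * l\<^sup>2" by (simp add: mult_ac)
    then have *: "real n * (\<bar>l\<bar> powr (2 + d) * moment (2 + d)) \<le> real n * (3 / 8 * \<epsilon> n * l\<^sup>2)"
      by (rule mult_left_mono) simp
    let ?c = "exp (- (real n * (3 / 8 * \<epsilon> n * l\<^sup>2)))"
    have "(\<integral>\<^sup>+\<omega>. h l \<omega> \<partial>M) = (\<integral>\<^sup>+\<omega>. ennreal ?c * ennreal (exp (l * ?S \<omega> - l\<^sup>2 / 2 * ?V \<omega>)) \<partial>M)"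
      using True by (intro nn_integral_cong)
        (simp add: h_def g_def ennreal_mult[symmetric] exp_add[symmetric] mult_ac)
    also have "\<dots> = ennreal ?c * (\<integral>\<^sup>+\<omega>. ennreal (exp (l * ?S \<omega> - l\<^sup>2 / 2 * ?V \<omega>)) \<partial>M)"
      by (rule nn_integral_cmult) measurable
    also have "\<dots> \<le> ennreal ?c * ennreal (exp (real n * (\<bar>l\<bar> powr (2 + d) * moment (2 + d))))"
      by (intro mult_left_mono nn_integral_exp_half_square_le[OF d int]) simp
    also have "\<dots> \<le> ennreal 1"
      unfolding ennreal_mult[OF exp_ge_zero exp_ge_zero, symmetric] exp_add[symmetric]
      using * by (intro ennreal_leI) simp
    finally show ?thesis by simp
  qed (simp add: h_def emeasure_space_1)
  have pointwise: "rws_e_variable X F \<theta> \<epsilon> T n \<omega>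
      \<le> (\<integral>\<^sup>+l. h l \<omega> \<partial>F) + ennreal (T n) * indicator bad \<omega>"
    if \<omega>: "\<omega> \<in> space M" for \<omega>
  proof (cases "\<omega> \<in> bad")
    case True
    then show ?thesis by (simp add: rws_e_variable_def min_le_iff_disj add_increasing)
  next
    case False
    note G = good[OF \<omega> False]
    define c where "c = real n * (sample_variance X n \<omega> + \<epsilon> n) / 2"
    have "0 \<le> c" unfolding c_def sample_variance_def
      using e by (intro divide_nonneg_nonneg mult_nonneg_nonneg add_nonneg_nonneg sum_nonneg) auto
    have "(?S \<omega>)\<^sup>2 / real n \<le> real n * (\<epsilon> n / 4)"
      using G n by (simp add: divide_le_eq power2_eq_square mult_ac)
    then have c: "c \<ge> ?V \<omega> / 2 + 3 / 8 * real n * \<epsilon> n"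
      unfolding c_def distrib_left sample_variance_eq[OF n, of X \<omega> \<theta>] by (simp add: field_simps)
    have le_g: "l * ?S \<omega> - c * l\<^sup>2 \<le> g l \<omega>" for l
      using mult_right_mono[OF c, of "l\<^sup>2"] by (simp add: g_def algebra_simps)
    have "L * \<bar>?S \<omega>\<bar> \<le> c * L\<^sup>2"
      using G mult_right_mono[OF c, of "L\<^sup>2"] by (simp add: algebra_simps)
    then have S: "\<bar>?S \<omega>\<bar> \<le> c * L" using L by (simp add: power2_eq_square)
    \<comment> \<open>Concavity: the exponent is nonpositive at the threshold, hence beyond it.\<close>
    have "exp (l * ?S \<omega> - c * l\<^sup>2) \<le> 1" if "\<not> \<bar>l\<bar> \<le> L" for l
    proof -
      have "l * ?S \<omega> \<le> \<bar>l\<bar> * \<bar>?S \<omega>\<bar>" by (simp add: abs_mult[symmetric])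
      also have "\<dots> \<le> \<bar>l\<bar> * (c * \<bar>l\<bar>)"
        using S that \<open>0 \<le> c\<close> by (intro mult_left_mono) (auto intro: order_trans[OF _ mult_left_mono])
      finally show ?thesis by (simp add: power2_eq_square mult_ac)
    qed
    then have "(\<integral>\<^sup>+l. ennreal (exp (l * ?S \<omega> - c * l\<^sup>2)) \<partial>F) \<le> (\<integral>\<^sup>+l. h l \<omega> \<partial>F)"
      using le_g by (intro nn_integral_mono) (auto simp: h_def simp flip: ennreal_1 intro!: ennreal_leI)
    then show ?thesis using False
      by (simp add: rws_e_variable_def min_le_iff_disj c_def mult_ac)
  qed
  have h_meas[measurable]: "(\<lambda>(l, \<omega>). h l \<omega>) \<in> borel_measurable (F \<Otimes>\<^sub>M M)"
    unfolding h_def g_def by measurable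
  have "(\<integral>\<^sup>+\<omega>. rws_e_variable X F \<theta> \<epsilon> T n \<omega> \<partial>M)
      \<le> (\<integral>\<^sup>+\<omega>. (\<integral>\<^sup>+l. h l \<omega> \<partial>F) + ennreal (T n) * indicator bad \<omega> \<partial>M)"
    by (intro nn_integral_mono pointwise)
  also have "\<dots> = (\<integral>\<^sup>+\<omega>. (\<integral>\<^sup>+l. h l \<omega> \<partial>F) \<partial>M) + (\<integral>\<^sup>+\<omega>. ennreal (T n) * indicator bad \<omega> \<partial>M)"
    by (rule nn_integral_add) measurable
  also have "(\<integral>\<^sup>+\<omega>. (\<integral>\<^sup>+l. h l \<omega> \<partial>F) \<partial>M) = (\<integral>\<^sup>+l. (\<integral>\<^sup>+\<omega>. h l \<omega> \<partial>M) \<partial>F)"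
    by (rule FM.Fubini'[OF h_meas])
  also have "\<dots> \<le> (\<integral>\<^sup>+l. 1 \<partial>F)"
    by (intro nn_integral_mono inside)
  also have "\<dots> = 1" using F.emeasure_space_1 by simp
  also have "(\<integral>\<^sup>+\<omega>. ennreal (T n) * indicator bad \<omega> \<partial>M) = ennreal (T n * prob bad)"
    using T by (simp add: nn_integral_cmult_indicator emeasure_eq_measure ennreal_mult)
  finally show ?thesis by (simp add: add_mono)
qed


text \<open>The three tail bounds are inserted with \<open>t = sqrt (\<epsilon> n) / 2\<close>, because
  \<open>|S| \<le> n t\<close> is the requirement \<open>S\<^sup>2 \<le> n\<^sup>2 \<epsilon>/4\<close> on the sum.\<close>
lemma nn_integral_rws_le_tails:
  assumes F: "real_distribution F" and n: "0 < n" and T: "0 \<le> T n" and e: "0 < \<epsilon> n"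
    and delta: "0 \<le> \<delta>" and int: "integrable P (\<lambda>x. \<bar>x - \<theta>\<bar> powr (2 + \<delta>))"
    and K: "1 + moment (2 + \<delta>) \<le> K" and v: "K \<le> v"
    and d: "0 \<le> d" "d \<le> 1" "d \<le> \<delta>" and L: "0 < L" "L powr d * moment (2 + d) \<le> \<epsilon> n / 4"
  shows "(\<integral>\<^sup>+\<omega>. rws_e_variable X F \<theta> \<epsilon> T n \<omega> \<partial>M)
    \<le> 1 + ennreal (T n * (2 * exp (- (real n * \<epsilon> n / (24 * v))) + K / v powr (1 + \<delta> / 2)
        + 2 * exp (- (real n * (L\<^sup>2 * (moment 2 + \<epsilon> n)) / 16))))"
proof -
  let ?S = "centered_sum X \<theta> n" and ?V = "centered_square_sum X \<theta> n"
  have "0 \<le> moment (2 + \<delta>)" by (rule integral_nonneg_AE) auto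
  then have v_pos: "0 < v" using K v by linarith
  have intd: "integrable P (\<lambda>x. \<bar>x - \<theta>\<bar> powr (2 + d))"
    and int2: "integrable P (\<lambda>x. \<bar>x - \<theta>\<bar> powr 2)"
    by (rule integrable_lower_moment(1)[OF int]; use d delta in simp)+
  have m2: "moment 2 \<le> v"
    using integrable_lower_moment(2)[OF int, of 2] delta K v by simp
  define t where "t = sqrt (\<epsilon> n) / 2"
  have t: "0 < t" "t\<^sup>2 = \<epsilon> n / 4" using e by (simp_all add: t_def power_divide)
  define A where "A = {\<omega>\<in>space M. real n * t \<le> \<bar>?S \<omega>\<bar> \<and> ?V \<omega> \<le> real n * v}"
  define B where "B = {\<omega>\<in>space M. real n * v \<le> ?V \<omega>}"
  define H where "H l = {\<omega>\<in>space M. 3 / 8 * real n * \<epsilon> n * l\<^sup>2 \<le> l * ?S \<omega> - l\<^sup>2 / 2 * ?V \<omega>}" for l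
  have [measurable]: "A \<in> events" "B \<in> events" "H l \<in> events" for l
    unfolding A_def B_def H_def by measurable
  have "prob A \<le> 2 * exp (- (real n * t\<^sup>2 / (6 * v)))"
    unfolding A_def by (rule self_normalized_tail_bound[OF int2 v_pos m2 t(1)])
  then have pA: "prob A \<le> 2 * exp (- (real n * \<epsilon> n / (24 * v)))" by (simp add: t(2))
  have "2 * (1 + \<delta> / 2) = 2 + \<delta>" by simp
  then have "prob B \<le> (1 + moment (2 + \<delta>)) / v powr (1 + \<delta> / 2)"
    using square_sum_tail_bound[of "1 + \<delta> / 2" n v] int n v_pos delta unfolding B_def by simp
  also have "\<dots> \<le> K / v powr (1 + \<delta> / 2)" using K by (intro divide_right_mono) auto
  finally have pB: "prob B \<le> K / v powr (1 + \<delta> / 2)" .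
  have pH: "prob (H l) \<le> exp (- (real n * (L\<^sup>2 * (moment 2 + \<epsilon> n)) / 16))" if "\<bar>l\<bar> = L" for l
    using threshold_tail_bound[OF d(1,2) intd, of l "\<epsilon> n" n] that L e power2_abs[of l]
    unfolding H_def by auto
  have "prob (A \<union> B \<union> (H L \<union> H (- L))) \<le> prob (A \<union> B) + prob (H L \<union> H (- L))"
    by (rule measure_Un_le) auto
  moreover have "prob (A \<union> B) \<le> prob A + prob B" by (rule measure_Un_le) auto
  moreover have "prob (H L \<union> H (- L)) \<le> prob (H L) + prob (H (- L))" by (rule measure_Un_le) auto
  moreover have "prob (H L) \<le> exp (- (real n * (L\<^sup>2 * (moment 2 + \<epsilon> n)) / 16))"
    "prob (H (- L)) \<le> exp (- (real n * (L\<^sup>2 * (moment 2 + \<epsilon> n)) / 16))"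
    by (rule pH; use L in simp)+
  ultimately have "prob (A \<union> B \<union> (H L \<union> H (- L))) \<le> 2 * exp (- (real n * \<epsilon> n / (24 * v)))
      + K / v powr (1 + \<delta> / 2) + 2 * exp (- (real n * (L\<^sup>2 * (moment 2 + \<epsilon> n)) / 16))"
    using pA pB by linarith
  then have "T n * prob (A \<union> B \<union> (H L \<union> H (- L))) \<le> T n * (2 * exp (- (real n * \<epsilon> n / (24 * v)))
      + K / v powr (1 + \<delta> / 2) + 2 * exp (- (real n * (L\<^sup>2 * (moment 2 + \<epsilon> n)) / 16)))"
    using T by (rule mult_left_mono)
  moreover have "(\<integral>\<^sup>+\<omega>. rws_e_variable X F \<theta> \<epsilon> T n \<omega> \<partial>M)
      \<le> 1 + ennreal (T n * prob (A \<union> B \<union> (H L \<union> H (- L))))"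
  proof (rule nn_integral_rws_le[where L = L and d = d])
    fix \<omega> assume \<omega>: "\<omega> \<in> space M" "\<omega> \<notin> A \<union> B \<union> (H L \<union> H (- L))"
    then have "\<bar>?S \<omega>\<bar> \<le> real n * t" unfolding A_def B_def by auto
    then have "(?S \<omega>)\<^sup>2 \<le> (real n * t)\<^sup>2" by (simp add: abs_le_square_iff[symmetric] power2_le_iff_abs_le t less_imp_le)
    also have "\<dots> = (real n)\<^sup>2 * (\<epsilon> n / 4)" by (simp add: power_mult_distrib t(2))
    finally show "(?S \<omega>)\<^sup>2 \<le> (real n)\<^sup>2 * (\<epsilon> n / 4) \<and>
        L * \<bar>?S \<omega>\<bar> - L\<^sup>2 / 2 * ?V \<omega> \<le> 3 / 8 * real n * \<epsilon> n * L\<^sup>2"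
      using \<omega> unfolding H_def by (cases "0 \<le> ?S \<omega>") auto
  qed (use F n T d L intd in auto)
  ultimately show ?thesis by (meson add_left_mono ennreal_leI order_trans)
qed

section \<open>Choice of the threshold\<close>

text \<open>Cauchy-Schwarz for \<open>|y|\<^sup>3 = |y| y\<^sup>2\<close>, by integrating \<open>0 \<le> y\<^sup>2 (a - |y|)\<^sup>2\<close> with
  \<open>a = K / moment 3\<close>.\<close>
lemma third_moment_square_le:
  assumes int: "integrable P (\<lambda>x. \<bar>x - \<theta>\<bar> powr 4)" and K: "moment 4 \<le> K" "0 < K"
  shows "(moment 3)\<^sup>2 \<le> moment 2 * K"
proof (cases "moment 3 = 0")
  case True
  have "0 \<le> moment 2" by (rule integral_nonneg_AE) auto
  then show ?thesis using True K by simp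
next
  case False
  moreover have "0 \<le> moment 3" by (rule integral_nonneg_AE) auto
  ultimately have pos: "0 < moment 3" by linarith
  have int': "integrable P (\<lambda>x. \<bar>x - \<theta>\<bar> powr 2)" "integrable P (\<lambda>x. \<bar>x - \<theta>\<bar> powr 3)"
    by (rule integrable_lower_moment(1)[OF int]; simp)+
  define a where "a = K / moment 3"
  have quad: "2 * a * y powr 3 \<le> a\<^sup>2 * y powr 2 + y powr 4" if "0 \<le> y" for y
  proof -
    have "0 \<le> y\<^sup>2 * (a - y)\<^sup>2" by simp
    also have "\<dots> = a\<^sup>2 * y ^ 2 + y ^ 4 - 2 * a * y ^ 3" by algebra
    finally show ?thesis using that by simp
  qed
  have "2 * K = 2 * a * moment 3" using pos by (simp add: a_def)
  also have "\<dots> = (\<integral>x. 2 * a * \<bar>x - \<theta>\<bar> powr 3 \<partial>P)" by (rule integral_mult_right_zero[symmetric])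
  also have "\<dots> \<le> (\<integral>x. a\<^sup>2 * \<bar>x - \<theta>\<bar> powr 2 + \<bar>x - \<theta>\<bar> powr 4 \<partial>P)"
    by (intro integral_mono Bochner_Integration.integrable_add integrable_mult_right int int' quad) simp
  also have "\<dots> = a\<^sup>2 * moment 2 + moment 4"
    by (subst Bochner_Integration.integral_add)
      (rule integrable_mult_right int int' | rule arg_cong2[where f = "(+)"] integral_mult_right_zero refl)+
  finally have "K \<le> a\<^sup>2 * moment 2" using K by linarith
  then have "(moment 3)\<^sup>2 * K \<le> (moment 3)\<^sup>2 * (a\<^sup>2 * moment 2)" by (rule mult_left_mono) simp
  also have "\<dots> = (moment 3 * a)\<^sup>2 * moment 2" by (simp only: power_mult_distrib mult_ac)
  also have "moment 3 * a = K" using pos by (simp add: a_def)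
  finally have "(moment 3)\<^sup>2 * K \<le> (moment 2 * K) * K" by (simp only: power2_eq_square mult_ac)
  then show ?thesis using K by (simp only: mult_le_cancel_right_pos)
qed

end

text \<open>The exponent of \<open>e\<close> in the lower bound for \<open>L\<^sup>2 (moment 2 + e)\<close> that a well-chosen threshold
  \<open>L\<close> achieves for a penalty \<open>e\<close>, see \<open>threshold_exists\<close> below.\<close>
definition decay_exponent :: "real \<Rightarrow> real" where
  "decay_exponent \<delta> = (if \<delta> \<le> 2 then 1 + 2 / min \<delta> 1 else 2)"

definition decay_constant :: "real \<Rightarrow> real \<Rightarrow> real" where
  "decay_constant \<delta> K = (4 * K) powr - (2 / min \<delta> 1)"

context iid_sample begin

text \<open>The largest admissible threshold satisfies \<open>L\<^sup>d moment (2 + d) = e/4\<close>.  For \<open>\<delta> \<le> 2\<close> it is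
  enough to use \<open>L\<^sup>2 (moment 2 + e) \<ge> L\<^sup>2 e\<close> and to bound the moment by \<open>K\<close>.  When \<open>\<delta>\<close> is
  large, the resulting power \<open>e\<^sup>3\<close> would be too small; for \<open>\<delta> > 2\<close> therefore \<open>d = 1\<close>, and
  \<open>L\<^sup>2 moment 2 = e\<^sup>2 moment 2 / (16 (moment 3)\<^sup>2) \<ge> e\<^sup>2 / (16 K)\<close> by Cauchy-Schwarz: a large third moment,
  which forces a small threshold, also forces a large variance.\<close>
lemma threshold_exists:
  assumes delta: "0 < \<delta>" and int: "integrable P (\<lambda>x. \<bar>x - \<theta>\<bar> powr (2 + \<delta>))"
    and K: "1 + moment (2 + \<delta>) \<le> K" and e: "0 < e"
  obtains d L where "0 \<le> d" "d \<le> 1" "d \<le> \<delta>" "0 < L" "L powr d * moment (2 + d) \<le> e / 4"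
    "decay_constant \<delta> K * e powr decay_exponent \<delta> \<le> L\<^sup>2 * (moment 2 + e)"
proof -
  have nonneg: "0 \<le> moment p" for p by (rule integral_nonneg_AE) auto
  have K1: "1 \<le> K" using K nonneg[of "2 + \<delta>"] by linarith
  show ?thesis
  proof (cases "\<delta> \<le> 2")
    case True
    define d where "d = min \<delta> 1"
    have d: "0 < d" "d \<le> 1" "d \<le> \<delta>" using delta by (auto simp: d_def)
    define L where "L = (e / (4 * K)) powr (1 / d)"
    have b: "0 < e / (4 * K)" using e K1 by simp
    have "L powr d = e / (4 * K)" using b d e K1 by (simp add: L_def powr_powr)
    moreover have "moment (2 + d) \<le> K"
      using integrable_lower_moment(2)[OF int, of "2 + d"] d K by simp
    ultimately have 1: "L powr d * moment (2 + d) \<le> e / 4"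
      using mult_left_mono[of "moment (2 + d)" K "e / (4 * K)"] b K1 by simp
    have L_pos: "0 < L" using e K1 by (simp add: L_def)
    have "decay_constant \<delta> K * e powr decay_exponent \<delta> = (4 * K) powr - (2 / d) * (e powr (2 / d) * e)"
      using True e by (simp add: decay_constant_def decay_exponent_def d_def powr_add)
    also have "\<dots> = (e / (4 * K)) powr (2 / d) * e"
      using e K1 by (simp add: powr_divide powr_minus_divide)
    also have "(e / (4 * K)) powr (2 / d) = L powr 2" by (simp add: L_def powr_powr)
    also have "\<dots> = L\<^sup>2" using L_pos by simp
    also have "L\<^sup>2 * e \<le> L\<^sup>2 * (moment 2 + e)" by (rule mult_left_mono) (simp_all only: nonneg le_add_same_cancel2 zero_le_power2)
    finally have "decay_constant \<delta> K * e powr decay_exponent \<delta> \<le> L\<^sup>2 * (moment 2 + e)" .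
    then show ?thesis using that[of d L] d 1 L_pos by simp
  next
    case False
    have int4: "integrable P (\<lambda>x. \<bar>x - \<theta>\<bar> powr 4)"
      by (rule integrable_lower_moment(1)[OF int]) (use False in auto)
    have m4: "moment 4 \<le> K"
      using integrable_lower_moment(2)[OF int, of 4] False K by simp
    have const: "decay_constant \<delta> K = 1 / (16 * K\<^sup>2)"
      using False K1 by (simp add: decay_constant_def powr_minus_divide power_mult_distrib)
    have expo: "e powr decay_exponent \<delta> = e\<^sup>2" using False e by (simp add: decay_exponent_def)
    have m3: "moment (2 + 1) = moment 3" by simp
    show ?thesis
    proof (cases "moment 3 = 0")
      case True
      \<comment> \<open>For a degenerate law every threshold is admissible.\<close>
      have "1 \<le> 16 * K\<^sup>2" using one_le_power[OF K1, of 2] by linarith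
      then have "1 / (16 * K\<^sup>2) \<le> 1" by (subst divide_le_eq_1_pos) linarith+
      then have "1 / (16 * K\<^sup>2) * e\<^sup>2 \<le> 1 * e\<^sup>2" by (rule mult_right_mono) simp
      also have "1 * e\<^sup>2 = (sqrt e)\<^sup>2 * e" using e by (simp add: power2_eq_square)
      also have "\<dots> \<le> (sqrt e)\<^sup>2 * (moment 2 + e)" by (rule mult_left_mono) (simp_all only: nonneg le_add_same_cancel2 zero_le_power2)
      finally show ?thesis
        using that[of 1 "sqrt e"] False e unfolding m3 const expo True by simp
    next
      case m3_ne: False
      then have pos: "0 < moment 3" using nonneg[of 3] by linarith
      define L where "L = e / (4 * moment 3)"
      have L: "0 < L" "L * moment 3 = e / 4" using pos e by (simp_all add: L_def)
      have "(moment 3)\<^sup>2 \<le> moment 2 * K" by (rule third_moment_square_le[OF int4 m4]) (use K1 in simp)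
      then have "L\<^sup>2 * (moment 3)\<^sup>2 \<le> L\<^sup>2 * (moment 2 * K)" by (rule mult_left_mono) simp
      moreover have "L\<^sup>2 * (moment 3)\<^sup>2 = e\<^sup>2 / 16"
        by (simp only: power_mult_distrib[symmetric] L) (simp add: power_divide)
      ultimately have 2: "e\<^sup>2 / (16 * K) \<le> L\<^sup>2 * moment 2"
        using K1 by (simp only:) (simp add: field_simps)
      have "1 / (16 * K\<^sup>2) * e\<^sup>2 \<le> e\<^sup>2 / (16 * K)"
        using K1 mult_right_mono[OF K1, of "e * e"] by (simp add: field_simps power2_eq_square)
      also note 2
      also have "L\<^sup>2 * moment 2 \<le> L\<^sup>2 * (moment 2 + e)" by (rule mult_left_mono) (use e in simp_all)
      finally show ?thesis
        using that[of 1 L] L False unfolding m3 const expo by simp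
    qed
  qed
qed

section \<open>Rates\<close>

text \<open>The level \<open>v\<close> for the mean square is as large as needed to make its tail probability
  \<open>n powr - (\<delta> \<gamma> / 2)\<close>.  Both exponentials then decay at least like
  \<open>exp (- c n powr (1 - 2 \<gamma>))\<close>, since \<open>\<delta>/(2 + \<delta>) + \<delta>/(4 + \<delta>) \<le> 2\<close> and
  \<open>decay_exponent \<delta> * \<delta> \<le> 2 (4 + \<delta>)\<close>.  The right side depends on the law only through \<open>K\<close>.\<close>
lemma nn_integral_rws_le_rate:
  assumes F: "real_distribution F" and n: "0 < n" and T: "0 \<le> T n"
    and delta: "0 < \<delta>" and gamma: "0 < \<gamma>" "\<gamma> < 1 / 2"
    and int: "integrable P (\<lambda>x. \<bar>x - \<theta>\<bar> powr (2 + \<delta>))" and K: "1 + moment (2 + \<delta>) \<le> K"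
    and e: "real n powr - (\<delta> * \<gamma> / (4 + \<delta>)) \<le> \<epsilon> n"
  shows "(\<integral>\<^sup>+\<omega>. rws_e_variable X F \<theta> \<epsilon> T n \<omega> \<partial>M)
    \<le> 1 + ennreal (T n * (4 * exp (- (min (1 / (24 * K)) (decay_constant \<delta> K / 16)
          * real n powr (1 - 2 * \<gamma>))) + real n powr - (\<delta> * \<gamma> / 2)))"
proof -
  define b where "b = \<delta> * \<gamma> / (4 + \<delta>)"
  define N where "N = real n powr (1 - 2 * \<gamma>)"
  define c where "c = min (1 / (24 * K)) (decay_constant \<delta> K / 16)"
  define v where "v = K * real n powr (\<delta> * \<gamma> / (2 + \<delta>))"
  have n1: "1 \<le> real n" using n by simp
  have b: "0 \<le> b" using delta gamma by (simp add: b_def)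
  have e': "real n powr - b \<le> \<epsilon> n" using e by (simp add: b_def)
  have e_pos: "0 < \<epsilon> n" using n by (intro less_le_trans[OF _ e']) simp
  have "0 \<le> moment (2 + \<delta>)" by (rule integral_nonneg_AE) auto
  then have K1: "1 \<le> K" using K by linarith
  have a: "0 \<le> \<delta> * \<gamma> / (2 + \<delta>)" using delta gamma by simp
  have v: "K \<le> v" unfolding v_def using K1 n1 ge_one_powr_ge_zero[OF n1 a] by simp
  obtain d L where dL: "0 \<le> d" "d \<le> 1" "d \<le> \<delta>" "0 < L" "L powr d * moment (2 + d) \<le> \<epsilon> n / 4"
    "decay_constant \<delta> K * \<epsilon> n powr decay_exponent \<delta> \<le> L\<^sup>2 * (moment 2 + \<epsilon> n)"
    using threshold_exists[OF delta int K e_pos] .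
  have A: "c * N \<le> real n * \<epsilon> n / (24 * v)"
  proof -
    have "2 * \<gamma> \<ge> \<delta> * \<gamma> / (2 + \<delta>) + b"
    proof -
      have "\<delta> / (2 + \<delta>) \<le> 1" "\<delta> / (4 + \<delta>) \<le> 1" using delta by auto
      then have "\<gamma> * (\<delta> / (2 + \<delta>) + \<delta> / (4 + \<delta>)) \<le> \<gamma> * 2" using gamma by (intro mult_left_mono) auto
      then show ?thesis by (simp add: b_def algebra_simps)
    qed
    then have "N \<le> real n powr (1 + - b - \<delta> * \<gamma> / (2 + \<delta>))"
      unfolding N_def using n1 by (intro powr_mono) auto
    also have "\<dots> = real n * real n powr - b / real n powr (\<delta> * \<gamma> / (2 + \<delta>))"
      using n by (simp only: powr_diff powr_add) simp
    also have "\<dots> \<le> real n * \<epsilon> n / real n powr (\<delta> * \<gamma> / (2 + \<delta>))"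
      using e' by (intro divide_right_mono mult_left_mono) auto
    finally have "1 / (24 * K) * N \<le> 1 / (24 * K) * (real n * \<epsilon> n / real n powr (\<delta> * \<gamma> / (2 + \<delta>)))"
      using K1 by (intro mult_left_mono) auto
    also have "\<dots> = real n * \<epsilon> n / (24 * v)" by (simp add: v_def)
    finally show ?thesis
      unfolding c_def N_def by (smt (verit) mult_right_mono powr_ge_zero)
  qed
  have B: "c * N \<le> real n * (L\<^sup>2 * (moment 2 + \<epsilon> n)) / 16"
  proof -
    let ?r = "decay_exponent \<delta>"
    have r: "0 \<le> ?r" using delta by (simp add: decay_exponent_def)
    have "?r * \<delta> \<le> 2 * (4 + \<delta>)"
      using delta by (auto simp: decay_exponent_def min_def field_simps)
    then have "?r * b \<le> 2 * \<gamma>"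
      using mult_right_mono[of "?r * \<delta>" "2 * (4 + \<delta>)" \<gamma>] gamma delta
      by (simp add: b_def pos_divide_le_eq mult_ac)
    then have "N \<le> real n powr (1 + (- b) * ?r)"
      unfolding N_def using n1 by (intro powr_mono) (auto simp: mult.commute)
    also have "\<dots> = real n * (real n powr - b) powr ?r"
      using n by (simp only: powr_add powr_powr) simp
    also have "\<dots> \<le> real n * \<epsilon> n powr ?r"
      using e' r by (intro mult_left_mono powr_mono2) auto
    finally have "decay_constant \<delta> K / 16 * N \<le> decay_constant \<delta> K / 16 * (real n * \<epsilon> n powr ?r)"
      by (intro mult_left_mono) (simp_all add: decay_constant_def)
    also have "\<dots> = real n * (decay_constant \<delta> K * \<epsilon> n powr ?r) / 16" by simp
    also have "\<dots> \<le> real n * (L\<^sup>2 * (moment 2 + \<epsilon> n)) / 16"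
      by (intro divide_right_mono mult_left_mono dL) simp_all
    finally show ?thesis
      unfolding c_def N_def by (smt (verit) mult_right_mono powr_ge_zero)
  qed
  have C: "K / v powr (1 + \<delta> / 2) \<le> real n powr - (\<delta> * \<gamma> / 2)"
  proof -
    have "\<delta> * \<gamma> / (2 + \<delta>) * (1 + \<delta> / 2) = \<delta> * \<gamma> / 2"
      using delta by (simp add: field_simps)
    then have "(real n powr (\<delta> * \<gamma> / (2 + \<delta>))) powr (1 + \<delta> / 2) = real n powr (\<delta> * \<gamma> / 2)"
      by (simp only: powr_powr)
    then have "v powr (1 + \<delta> / 2) = K powr (1 + \<delta> / 2) * real n powr (\<delta> * \<gamma> / 2)"
      using K1 by (simp add: v_def powr_mult)
    moreover have "K powr 1 \<le> K powr (1 + \<delta> / 2)" using K1 delta by (intro powr_mono) auto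
    ultimately have "K / v powr (1 + \<delta> / 2) \<le> 1 / real n powr (\<delta> * \<gamma> / 2)"
      using K1 n by (simp add: divide_simps)
    then show ?thesis by (simp add: powr_minus_divide)
  qed
  have "(\<integral>\<^sup>+\<omega>. rws_e_variable X F \<theta> \<epsilon> T n \<omega> \<partial>M)
    \<le> 1 + ennreal (T n * (2 * exp (- (real n * \<epsilon> n / (24 * v))) + K / v powr (1 + \<delta> / 2)
        + 2 * exp (- (real n * (L\<^sup>2 * (moment 2 + \<epsilon> n)) / 16))))"
    by (rule nn_integral_rws_le_tails[where d = d]) (use F n T e_pos delta int K v dL in auto)
  also have "\<dots> \<le> 1 + ennreal (T n * (4 * exp (- (c * N)) + real n powr - (\<delta> * \<gamma> / 2)))"
  proof (intro add_left_mono ennreal_leI mult_left_mono[OF _ T])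
    have "exp (- (real n * \<epsilon> n / (24 * v))) \<le> exp (- (c * N))"
      "exp (- (real n * (L\<^sup>2 * (moment 2 + \<epsilon> n)) / 16)) \<le> exp (- (c * N))"
      using A B by (simp_all only: exp_le_cancel_iff neg_le_iff_le)
    then show "2 * exp (- (real n * \<epsilon> n / (24 * v))) + K / v powr (1 + \<delta> / 2)
        + 2 * exp (- (real n * (L\<^sup>2 * (moment 2 + \<epsilon> n)) / 16))
        \<le> 4 * exp (- (c * N)) + real n powr - (\<delta> * \<gamma> / 2)"
      using C by linarith
  qed
  finally show ?thesis unfolding c_def N_def .
qed

end


text \<open>A divergent \<open>T\<close> is eventually at least 1, so its rate bound must be at least 1 as well; solve
  for \<open>\<epsilon> n\<close>.\<close>
lemma eventually_rate_imp_lower_bound: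
  fixes T \<epsilon> :: "nat \<Rightarrow> real"
  assumes w: "0 < w" and T: "filterlim T at_top sequentially" and eps: "\<And>n. 0 \<le> \<epsilon> n"
    and rate: "T \<in> o(\<lambda>n. real n powr p * \<epsilon> n powr w)"
  shows "\<forall>\<^sub>F n in sequentially. real n powr - (p / w) \<le> \<epsilon> n"
proof -
  have "\<forall>\<^sub>F n in sequentially. norm (T n) \<le> 1 * norm (real n powr p * \<epsilon> n powr w)"
    using landau_o.smallD[OF rate, of 1] by simp
  moreover have "\<forall>\<^sub>F n in sequentially. 1 \<le> T n"
    using T unfolding filterlim_at_top by blast
  moreover have "\<forall>\<^sub>F n in sequentially. 0 < n" by (rule eventually_gt_at_top)
  ultimately show ?thesis
  proof eventually_elim
    case (elim n)
    have "1 \<le> real n powr p * \<epsilon> n powr w" using elim by (simp add: abs_mult)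
    then have "real n powr - p \<le> \<epsilon> n powr w"
      using elim by (simp add: powr_minus_divide divide_le_eq mult.commute)
    then have "(real n powr - p) powr (1 / w) \<le> (\<epsilon> n powr w) powr (1 / w)"
      using w by (intro powr_mono2) auto
    then show ?case using w eps[of n] by (simp add: powr_powr)
  qed
qed

text \<open>Since \<open>\<epsilon>\<close> is eventually below 1, \<open>T n\<close> is \<open>o (n powr p)\<close>.\<close>
lemma truncation_times_tail_tendsto_0:
  fixes T \<epsilon> :: "nat \<Rightarrow> real"
  assumes c: "0 < c" and b: "0 < b" and p: "0 < p" and w: "0 < w"
    and eps: "\<And>n. 0 \<le> \<epsilon> n" "\<epsilon> \<longlonglongrightarrow> 0"
    and rate: "T \<in> o(\<lambda>n. real n powr p * \<epsilon> n powr w)"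
  shows "(\<lambda>n. T n * (4 * exp (- (c * real n powr b)) + real n powr - p)) \<longlonglongrightarrow> 0"
proof -
  have "\<forall>\<^sub>F n in sequentially. \<epsilon> n < 1"
    using eps(2) by (rule order_tendstoD) simp
  then have "\<forall>\<^sub>F n in sequentially. norm (real n powr p * \<epsilon> n powr w) \<le> 1 * norm (real n powr p)"
  proof eventually_elim
    case (elim n)
    have "\<epsilon> n powr w \<le> 1 powr w" using elim eps(1) w by (intro powr_mono2) auto
    then have "real n powr p * \<epsilon> n powr w \<le> real n powr p * 1" by (intro mult_left_mono) auto
    then show ?case by (simp add: abs_mult)
  qed
  then have "(\<lambda>n. real n powr p * \<epsilon> n powr w) \<in> O(\<lambda>n. real n powr p)" by (rule bigoI)
  with rate have "T \<in> o(\<lambda>n. real n powr p)" by (rule landau_o.small_big_trans)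
  then have T: "(\<lambda>n. T n / real n powr p) \<longlonglongrightarrow> 0" by (rule smalloD_tendsto)
  have "(\<lambda>n. 4 * (real n powr p * exp (- (c * real n powr b))) + 1) \<longlonglongrightarrow> 1"
    using b c p by real_asymp
  with T have "(\<lambda>n. T n / real n powr p * (4 * (real n powr p * exp (- (c * real n powr b))) + 1)) \<longlonglongrightarrow> 0 * 1"
    by (rule tendsto_mult)
  moreover have "\<forall>\<^sub>F n in sequentially.
      T n / real n powr p * (4 * (real n powr p * exp (- (c * real n powr b))) + 1)
      = T n * (4 * exp (- (c * real n powr b)) + real n powr - p)"
    using eventually_gt_at_top[of 0]
    by eventually_elim (simp add: powr_minus_divide field_simps)
  ultimately show ?thesis by (simp add: tendsto_cong)
qed

section \<open>From the moment class to asymptotic e-variables\<close>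

lemma iid_sample_moment_class:
  assumes "iid_with_law M X P" "P \<in> moment_class q \<theta>"
  shows "iid_sample M X P \<theta>"
  using assms unfolding iid_sample_def iid_sample_axioms_def iid_with_law_def moment_class_def by auto

lemma integrable_moment_class:
  assumes "P \<in> moment_class q \<theta>"
  shows "integrable P (\<lambda>x. \<bar>x - \<theta>\<bar> powr q)"
proof -
  interpret real_distribution P using assms by (simp add: moment_class_def)
  show ?thesis
    using assms by (intro integrableI_bounded) (auto simp: moment_class_def)
qed

text \<open>A uniform bound on the raw moment of the observations bounds the centered moments of the
  laws uniformly, by \<open>|x - \<theta>| \<le> 2 max |x| |\<theta>|\<close>.\<close>
lemma centered_moment_le:
  assumes P: "P \<in> moment_class q \<theta>" and iid: "iid_with_law M X P" and q: "0 \<le> q"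
    and B: "(\<integral>\<^sup>+\<omega>. ennreal (\<bar>X 0 \<omega>\<bar> powr q) \<partial>M) \<le> ennreal B" "0 \<le> B"
  shows "(\<integral>x. \<bar>x - \<theta>\<bar> powr q \<partial>P) \<le> 2 powr q * (B + \<bar>\<theta>\<bar> powr q)"
proof -
  interpret iid_sample M X P \<theta> by (rule iid_sample_moment_class[OF iid P])
  interpret P: prob_space P by (rule prob_space_P)
  have le: "\<bar>x - \<theta>\<bar> powr q \<le> 2 powr q * (\<bar>x\<bar> powr q + \<bar>\<theta>\<bar> powr q)" for x
  proof -
    have "\<bar>x - \<theta>\<bar> powr q \<le> (2 * max \<bar>x\<bar> \<bar>\<theta>\<bar>) powr q" using q by (intro powr_mono2) auto
    also have "\<dots> = 2 powr q * max \<bar>x\<bar> \<bar>\<theta>\<bar> powr q" by (simp add: powr_mult)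
    also have "\<dots> \<le> 2 powr q * (\<bar>x\<bar> powr q + \<bar>\<theta>\<bar> powr q)"
      by (intro mult_left_mono) (auto simp: max_def)
    finally show ?thesis .
  qed
  have X0: "(\<integral>\<^sup>+x. ennreal (\<bar>x\<bar> powr q) \<partial>P) \<le> ennreal B"
    unfolding law[of 0, symmetric] using B by (subst nn_integral_distr) auto
  have "ennreal (\<integral>x. \<bar>x - \<theta>\<bar> powr q \<partial>P) = (\<integral>\<^sup>+x. ennreal (\<bar>x - \<theta>\<bar> powr q) \<partial>P)"
    by (rule nn_integral_eq_integral[OF integrable_moment_class[OF P], symmetric]) auto
  also have "\<dots> \<le> (\<integral>\<^sup>+x. ennreal (2 powr q) * (ennreal (\<bar>x\<bar> powr q) + ennreal (\<bar>\<theta>\<bar> powr q)) \<partial>P)"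
    using le by (intro nn_integral_mono) (simp flip: ennreal_mult ennreal_plus)
  also have "\<dots> = ennreal (2 powr q) * ((\<integral>\<^sup>+x. ennreal (\<bar>x\<bar> powr q) \<partial>P) + ennreal (\<bar>\<theta>\<bar> powr q))"
    using P.emeasure_space_1 by (simp add: nn_integral_cmult nn_integral_add)
  also have "\<dots> \<le> ennreal (2 powr q) * (ennreal B + ennreal (\<bar>\<theta>\<bar> powr q))"
    by (intro mult_left_mono add_right_mono X0) simp
  also have "\<dots> = ennreal (2 powr q * (B + \<bar>\<theta>\<bar> powr q))"
    using B by (simp add: ennreal_mult)
  finally show ?thesis using B by (subst (asm) ennreal_le_iff) auto
qed

theorem theorem3p8:
  fixes \<theta> \<gamma> \<delta> :: real
    and T \<epsilon> :: "nat \<Rightarrow> real"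
    and F :: "real measure"
    and Pr :: "real measure \<Rightarrow> 'w measure"
    and X :: "nat \<Rightarrow> 'w \<Rightarrow> real"
  assumes iid: "\<And>P. P \<in> moment_class (2 + \<delta>) \<theta> \<Longrightarrow> iid_with_law (Pr P) X P"
    and gamma: "0 < \<gamma>" "\<gamma> < 1 / 2"
    and delta: "0 < \<delta>"
    and T: "\<And>n. 0 \<le> T n" "incseq T" "filterlim T at_top sequentially"
    and eps: "\<And>n. 0 \<le> \<epsilon> n" "decseq \<epsilon>" "\<epsilon> \<longlonglongrightarrow> 0"
    and rate: "T \<in> o(\<lambda>n. real n powr (\<delta> * \<gamma> / 2) * \<epsilon> n powr (2 + \<delta> / 2))"
    and F: "real_distribution F"
  shows "asymptotic_e_variable Pr (moment_class (2 + \<delta>) \<theta>) (rws_e_variable X F \<theta> \<epsilon> T) \<and>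
    (\<forall>\<P>. \<P> \<subseteq> moment_class (2 + \<delta>) \<theta> \<and> uniformly_bounded_moment Pr \<P> (2 + \<delta>) X
         \<longrightarrow> uniform_asymptotic_e_variable Pr \<P> (rws_e_variable X F \<theta> \<epsilon> T))"
proof -
  let ?E = "rws_e_variable X F \<theta> \<epsilon> T"
  let ?class = "moment_class (2 + \<delta>) \<theta>"
  have sample: "iid_sample (Pr P) X P \<theta>" if "P \<in> ?class" for P
    using iid_sample_moment_class[OF iid[OF that] that] .
  have meas: "?E n \<in> borel_measurable (Pr P)" if "P \<in> ?class" for P n
    by (rule iid_sample.measurable_rws_e_variable[OF sample[OF that] F])
  \<comment> \<open>Both claims are instances of this one: the first for singletons, the second with a common \<open>K\<close>.\<close>
  have uniform: "limsup (\<lambda>n. SUP P\<in>\<P>. \<integral>\<^sup>+\<omega>. ?E n \<omega> \<partial>Pr P) \<le> 1"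
    if sub: "\<P> \<subseteq> ?class" and K: "\<And>P. P \<in> \<P> \<Longrightarrow> 1 + (\<integral>x. \<bar>x - \<theta>\<bar> powr (2 + \<delta>) \<partial>P) \<le> K" "1 \<le> K"
    for \<P> K
  proof -
    define c where "c = min (1 / (24 * K)) (decay_constant \<delta> K / 16)"
    have c: "0 < c" using K(2) by (simp add: c_def decay_constant_def)
    define R where "R n = T n * (4 * exp (- (c * real n powr (1 - 2 * \<gamma>))) + real n powr - (\<delta> * \<gamma> / 2))" for n
    have R: "R \<longlonglongrightarrow> 0" unfolding R_def
      by (rule truncation_times_tail_tendsto_0[OF c _ _ _ eps(1,3) rate]) (use gamma delta in auto)
    have "2 + \<delta> / 2 = (4 + \<delta>) / 2" by simp
    then have "\<delta> * \<gamma> / 2 / (2 + \<delta> / 2) = \<delta> * \<gamma> / (4 + \<delta>)" by (simp only:) simp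
    then have "\<forall>\<^sub>F n in sequentially. real n powr - (\<delta> * \<gamma> / (4 + \<delta>)) \<le> \<epsilon> n"
      using eventually_rate_imp_lower_bound[OF _ T(3) eps(1) rate] delta by simp
    then have "\<forall>\<^sub>F n in sequentially. (SUP P\<in>\<P>. \<integral>\<^sup>+\<omega>. ?E n \<omega> \<partial>Pr P) \<le> 1 + ennreal (R n)"
      using eventually_gt_at_top[of 0]
    proof eventually_elim
      case (elim n)
      show ?case
      proof (rule SUP_least)
        fix P assume P: "P \<in> \<P>"
        then have "P \<in> ?class" using sub by blast
        then show "(\<integral>\<^sup>+\<omega>. ?E n \<omega> \<partial>Pr P) \<le> 1 + ennreal (R n)"
          unfolding R_def c_def
          using iid_sample.nn_integral_rws_le_rate[where \<epsilon> = \<epsilon> and T = T and n = n and \<gamma> = \<gamma>,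
              OF sample F elim(2) T(1) delta gamma integrable_moment_class K(1)[OF P] elim(1)]
          by blast
      qed
    qed
    then have "limsup (\<lambda>n. SUP P\<in>\<P>. \<integral>\<^sup>+\<omega>. ?E n \<omega> \<partial>Pr P) \<le> limsup (\<lambda>n. 1 + ennreal (R n))"
      by (rule Limsup_mono)
    also have "(\<lambda>n. 1 + ennreal (R n)) \<longlonglongrightarrow> 1 + ennreal 0"
      by (intro tendsto_intros tendsto_ennrealI R)
    then have "limsup (\<lambda>n. 1 + ennreal (R n)) = 1"
      by (simp add: lim_imp_Limsup)
    finally show ?thesis .
  qed
  have "limsup (\<lambda>n. \<integral>\<^sup>+\<omega>. ?E n \<omega> \<partial>Pr P) \<le> 1" if "P \<in> ?class" for P
    using uniform[of "{P}" "1 + (\<integral>x. \<bar>x - \<theta>\<bar> powr (2 + \<delta>) \<partial>P)"] that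
    by (simp add: integral_nonneg_AE)
  moreover have "uniform_asymptotic_e_variable Pr \<P> ?E"
    if sub: "\<P> \<subseteq> ?class" and bdd: "uniformly_bounded_moment Pr \<P> (2 + \<delta>) X" for \<P>
  proof -
    let ?B = "SUP P\<in>\<P>. \<integral>\<^sup>+\<omega>. ennreal (\<bar>X 0 \<omega>\<bar> powr (2 + \<delta>)) \<partial>Pr P"
    define B where "B = enn2real ?B"
    have "?B < top" using bdd unfolding uniformly_bounded_moment_def infinity_ennreal_def .
    then have B: "ennreal B = ?B" "0 \<le> B"
      unfolding B_def by (rule ennreal_enn2real, intro enn2real_nonneg)
    let ?K = "1 + 2 powr (2 + \<delta>) * (B + \<bar>\<theta>\<bar> powr (2 + \<delta>))"
    have "limsup (\<lambda>n. SUP P\<in>\<P>. \<integral>\<^sup>+\<omega>. ?E n \<omega> \<partial>Pr P) \<le> 1"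
    proof (rule uniform[OF sub])
      fix P assume P: "P \<in> \<P>"
      then have "P \<in> ?class" using sub by blast
      moreover have "(\<integral>\<^sup>+\<omega>. ennreal (\<bar>X 0 \<omega>\<bar> powr (2 + \<delta>)) \<partial>Pr P) \<le> ennreal B"
        unfolding B(1) using P by (rule SUP_upper)
      ultimately show "1 + (\<integral>x. \<bar>x - \<theta>\<bar> powr (2 + \<delta>) \<partial>P) \<le> ?K"
        using centered_moment_le[OF _ iid, of P] B(2) delta by simp
    qed (use B(2) in simp)
    then show ?thesis
      unfolding uniform_asymptotic_e_variable_def using meas sub by blast
  qed
  ultimately show ?thesis
    unfolding asymptotic_e_variable_def using meas by blast
qed

end
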